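(* Let $k$ be a positive integer and let $\lambda$ be an integer partition of $k$ of length $\ell$ with no part equal to $1$. If $\mathbf{S}$ is a $\lambda$-uniform $k$-regular graph-like scheduling problem and $$e\,(k(k-1)+1)\,2^{-k} < 2^{-\ell},$$ where $e$ is the base of the natural logarithm, then $\mathbf{S}$ has property B. Hence, for any fixed $\ell > 0$ there exists $K>0$ such that for all $k \geq K$, any $\lambda$-uniform $k$-regular graph-like scheduling problem, where $\lambda$ is an integer partition of $k$ of length $\ell$ with no part equal to $1$, has property B.
   Context: A graph-like scheduling problem on $n$ elements is a Boolean formula $\mathbf{S} = \bigwedge_{\alpha \in J} \mathbf{C}_\alpha$ ($J$ finite) where each clause is a disjunction $\mathbf{C} = \bigvee_{(i,j)\in I} (x_i \neq x_j)$ with $i,j \in [n]=\{1,\dots,n\}$ and $i \neq j$ for $(i,j)\in I$. A solution is an assignment of a nonnegative integer to each $x_i$ making $\mathbf{S}$ true. $\mathbf{S}$ has property B if it has a solution in which each $x_i$, $i\in[n]$, is assigned $0$ or $1$. For a clause $\mathbf{C} = \bigvee_{(i,j)\in I} (x_i \neq x_j)$, $G_{\mathbf{C}}$ is the graph with vertex set $V_{\mathbf{C}} = \{i : (i,j)\in I \text{ or } (j,i)\in I \text{ for some } j\}$ and edge set $\{ij : (i,j)\in I\}$, and $\lambda(\mathbf{C})$ is the integer partition of $|V_{\mathbf{C}}|$ given by the sizes of the connected components of $G_{\mathbf{C}}$. Two clauses whose graphs have the same connected components (same vertex sets of components) are logically equivalent and are identified. Integer partitions are weakly decreasing finite sequences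 of positive integers; the length is the number of parts. $\mathbf{S}$ is $\lambda$-uniform if $\lambda(\mathbf{C}_\alpha)=\lambda$ for every $\alpha\in J$. $\mathbf{S}$ on $n$ elements is $k$-regular if for all $i\in[n]$ we have $\big|\{\mathbf{C}_\alpha : i \in V_{\mathbf{C}_\alpha}\}\big| = k$. Note that the same $k$ is used for the regularity and for the integer partitioned by $\lambda$. *)

theory Defs
  imports Complex_Main "HOL-Library.Multiset"
begin

type_synonym clause = "(nat \<times> nat) set"

text \<open>
  The set \<open>C\<close> of pairs encodes the disjunction of the literals \<open>x i \<noteq> x j\<close> for \<open>(i, j) \<in> C\<close>
  (the empty clause is false), and a set of clauses encodes their conjunction.
\<close>

definition scheduling_problem :: "nat \<Rightarrow> clause set \<Rightarrow> bool" where
  "scheduling_problem n S \<longleftrightarrow>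
     finite S \<and> (\<forall>C\<in>S. \<forall>(i, j)\<in>C. i \<in> {1..n} \<and> j \<in> {1..n} \<and> i \<noteq> j)"

definition satisfies_clause :: "(nat \<Rightarrow> nat) \<Rightarrow> clause \<Rightarrow> bool" where
  "satisfies_clause x C \<longleftrightarrow> (\<exists>(i, j)\<in>C. x i \<noteq> x j)"

definition solution :: "(nat \<Rightarrow> nat) \<Rightarrow> clause set \<Rightarrow> bool" where
  "solution x S \<longleftrightarrow> (\<forall>C\<in>S. satisfies_clause x C)"

definition property_B :: "nat \<Rightarrow> clause set \<Rightarrow> bool" where
  "property_B n S \<longleftrightarrow> (\<exists>x. solution x S \<and> (\<forall>i\<in>{1..n}. x i \<in> {0, 1}))"

text \<open>
  The graph of a clause \<open>C\<close> has vertex set \<open>Field C\<close> and an undirected edge \<open>ij\<close> for each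
  \<open>(i, j) \<in> C\<close>. Its connected components are the classes of the reachability relation.
\<close>

definition components :: "clause \<Rightarrow> nat set set" where
  "components C = Field C // (C \<union> C\<inverse>)\<^sup>*"

text \<open>Integer partitions are weakly decreasing lists of positive integers.\<close>

definition integer_partition :: "nat \<Rightarrow> nat list \<Rightarrow> bool" where
  "integer_partition k p \<longleftrightarrow> sorted_wrt (\<ge>) p \<and> (\<forall>a\<in>set p. 0 < a) \<and> sum_list p = k"

definition clause_partition :: "clause \<Rightarrow> nat list" where
  "clause_partition C =
     rev (sorted_list_of_multiset (image_mset card (mset_set (components C))))"

definition uniform :: "nat list \<Rightarrow> clause set \<Rightarrow> bool" where
  "uniform p S \<longleftrightarrow> (\<forall>C\<in>S. clause_partition C = p)"

text \<open>
  Clauses whose graphs have the same connected components are identified, so that regularity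
  counts the clauses containing \<open>i\<close> by their component sets rather than as sets of pairs.
\<close>

definition regular :: "nat \<Rightarrow> nat \<Rightarrow> clause set \<Rightarrow> bool" where
  "regular n k S \<longleftrightarrow> (\<forall>i\<in>{1..n}. card (components ` {C\<in>S. i \<in> Field C}) = k)"

end

theory Submission
  imports Defs "HOL-Real_Asymp.Real_Asymp"
begin

text \<open>
  Colour every element \<open>0\<close> or \<open>1\<close> independently and uniformly at random.  A clause fails exactly
  when every connected component of its graph is monochromatic.  A failing colouring of its \<open>k\<close>
  vertices is determined by the set of components coloured \<open>1\<close>, so a clause with \<open>l\<close> components
  fails with probability at most \<open>2\<^sup>l / 2\<^sup>k\<close>.  Failure of a clause is independent of what happens
  to the clauses that share no vertex with it, and by regularity at most \<open>k (k - 1)\<close> other clauses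
  share one of its \<open>k\<close> vertices.  The assumed inequality therefore says that \<open>e (d + 1) p < 1\<close> with
  \<open>p = 2\<^sup>l / 2\<^sup>k\<close> and \<open>d = k (k - 1)\<close>, and the symmetric Lovasz local lemma yields a colouring in
  which no clause fails.

  The probability space is finite and uniform, so probabilities are ratios of cardinalities, and
  the local lemma is proved by counting the outcomes that avoid a given set of events
  (\<open>lovasz_local_lemma_symmetric\<close>).  It is applied to families of sets of blocks, the component
  sets of the clauses, in \<open>exists_splitting_set\<close>; this is also the level at which clauses with the
  same components become equal, as the regularity hypothesis demands.  The second half of the
  theorem holds because \<open>k\<^sup>2 / 2\<^sup>k\<close> tends to \<open>0\<close>.
\<close>

section \<open>The Lovasz local lemma by counting\<close>

definition avoiding :: "'w set \<Rightarrow> ('i \<Rightarrow> 'w set) \<Rightarrow> 'i set \<Rightarrow> 'w set" where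
  "avoiding \<Omega> A T = {w \<in> \<Omega>. \<forall>j\<in>T. w \<notin> A j}"

lemma avoiding_empty [simp]: "avoiding \<Omega> A {} = \<Omega>"
  by (simp add: avoiding_def)

lemma avoiding_antimono: "T \<subseteq> T' \<Longrightarrow> avoiding \<Omega> A T' \<subseteq> avoiding \<Omega> A T"
  by (auto simp: avoiding_def)

lemma finite_avoiding [simp]: "finite \<Omega> \<Longrightarrow> finite (avoiding \<Omega> A T)"
  by (simp add: avoiding_def)

text \<open>
  The chain rule for conditional probabilities: if every event indexed by \<open>U\<close> has probability at
  most \<open>x\<close> conditioned on avoiding other events from \<open>U \<union> T\<close>, then the events of \<open>U\<close> can be added
  one at a time to those to be avoided, each at the cost of at most a factor \<open>1 - x\<close>.
\<close>

lemma card_avoiding_Un_ge: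
  fixes x :: real
  assumes "finite \<Omega>" "finite U" "U \<inter> T = {}" "x \<le> 1"
    and cond: "\<And>j W. j \<in> U \<Longrightarrow> j \<notin> W \<Longrightarrow> W \<subseteq> U \<union> T \<Longrightarrow>
      real (card (A j \<inter> avoiding \<Omega> A W)) \<le> x * real (card (avoiding \<Omega> A W))"
  shows "(1 - x) ^ card U * real (card (avoiding \<Omega> A T)) \<le> real (card (avoiding \<Omega> A (U \<union> T)))"
  using assms(2,3,5)
proof (induction U rule: finite_induct)
  case empty
  then show ?case by simp
next
  case (insert j U)
  let ?N = "avoiding \<Omega> A (U \<union> T)"
  have IH: "(1 - x) ^ card U * real (card (avoiding \<Omega> A T)) \<le> real (card ?N)"
    using insert.prems by (intro insert.IH) auto
  have split: "avoiding \<Omega> A (insert j U \<union> T) = ?N - (A j \<inter> ?N)"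
    by (auto simp: avoiding_def)
  have "real (card (A j \<inter> ?N)) \<le> x * real (card ?N)"
    using insert.prems insert.hyps by (intro insert.prems(2)) auto
  moreover have "card (avoiding \<Omega> A (insert j U \<union> T)) = card ?N - card (A j \<inter> ?N)"
    unfolding split using \<open>finite \<Omega>\<close> by (intro card_Diff_subset) auto
  moreover have "card (A j \<inter> ?N) \<le> card ?N"
    using \<open>finite \<Omega>\<close> by (intro card_mono) auto
  ultimately have step: "(1 - x) * real (card ?N) \<le> real (card (avoiding \<Omega> A (insert j U \<union> T)))"
    by (simp add: of_nat_diff algebra_simps)
  have "(1 - x) ^ card (insert j U) * real (card (avoiding \<Omega> A T))
      = (1 - x) * ((1 - x) ^ card U * real (card (avoiding \<Omega> A T)))"
    using insert.hyps by simp
  also have "\<dots> \<le> (1 - x) * real (card ?N)"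
    using IH \<open>x \<le> 1\<close> by (intro mult_left_mono) auto
  finally show ?case using step by simp
qed

text \<open>
  The heart of the local lemma: conditioning on avoiding any set of other events leaves the
  probability of an event at most \<open>x\<close>.  Of the avoided events, those outside the neighbourhood
  leave the bound \<open>p\<close> intact, and avoiding the at most \<open>d\<close> neighbours as well keeps at least a
  fraction \<open>(1 - x)\<^sup>d\<close> of the conditioning event, by the chain rule and induction on the number of
  avoided events.  The condition on \<open>p\<close> pays for this loss.
\<close>

lemma local_lemma_conditional_bound:
  fixes x p :: real
  assumes "finite \<Omega>" "finite I" "0 \<le> x" "x \<le> 1"
    and deg: "\<And>i. i \<in> I \<Longrightarrow> card (I \<inter> N i) \<le> d"
    and prob: "\<And>i T. i \<in> I \<Longrightarrow> T \<subseteq> I - N i - {i} \<Longrightarrow>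
      real (card (A i \<inter> avoiding \<Omega> A T)) \<le> p * real (card (avoiding \<Omega> A T))"
    and p: "p \<le> x * (1 - x) ^ d"
    and "T \<subseteq> I" "i \<in> I" "i \<notin> T"
  shows "real (card (A i \<inter> avoiding \<Omega> A T)) \<le> x * real (card (avoiding \<Omega> A T))"
  using assms(8-10)
proof (induction "card T" arbitrary: T i rule: less_induct)
  case less
  define T1 where "T1 = T \<inter> N i"
  define T2 where "T2 = T - N i"
  have T: "T = T1 \<union> T2" "T1 \<inter> T2 = {}" by (auto simp: T1_def T2_def)
  have fin: "finite T" using less.prems \<open>finite I\<close> finite_subset by blast
  have "card T1 \<le> card (I \<inter> N i)"
    using less.prems \<open>finite I\<close> by (intro card_mono) (auto simp: T1_def)
  then have T1_card: "card T1 \<le> d" using deg[OF \<open>i \<in> I\<close>] by simp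
  have nbrs: "(1 - x) ^ card T1 * real (card (avoiding \<Omega> A T2)) \<le> real (card (avoiding \<Omega> A T))"
    unfolding T(1)
  proof (rule card_avoiding_Un_ge)
    fix j W assume jW: "j \<in> T1" "j \<notin> W" "W \<subseteq> T1 \<union> T2"
    then have "W \<subset> T" using T(1) by auto
    then have "card W < card T" using fin by (simp add: psubset_card_mono)
    then show "real (card (A j \<inter> avoiding \<Omega> A W)) \<le> x * real (card (avoiding \<Omega> A W))"
      using jW T(1) less.prems by (intro less.hyps) auto
  qed (use fin T(2) assms in \<open>auto simp: T1_def\<close>)
  have "real (card (A i \<inter> avoiding \<Omega> A T)) \<le> real (card (A i \<inter> avoiding \<Omega> A T2))"
    using \<open>finite \<Omega>\<close> avoiding_antimono[of T2 T \<Omega> A] by (intro of_nat_mono card_mono) (auto simp: T2_def)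
  also have "\<dots> \<le> p * real (card (avoiding \<Omega> A T2))"
    using less.prems by (intro prob) (auto simp: T2_def)
  also have "\<dots> \<le> x * (1 - x) ^ d * real (card (avoiding \<Omega> A T2))"
    using p by (intro mult_right_mono) auto
  also have "\<dots> \<le> x * (1 - x) ^ card T1 * real (card (avoiding \<Omega> A T2))"
    using T1_card assms(3,4) by (intro mult_right_mono mult_left_mono power_decreasing) auto
  also have "\<dots> \<le> x * real (card (avoiding \<Omega> A T))"
    using nbrs \<open>0 \<le> x\<close> by (simp add: mult.assoc mult_left_mono)
  finally show ?case .
qed

lemma lovasz_local_lemma:
  fixes x p :: real
  assumes "finite \<Omega>" "\<Omega> \<noteq> {}" "finite I" "0 \<le> x" "x < 1"
    and deg: "\<And>i. i \<in> I \<Longrightarrow> card (I \<inter> N i) \<le> d"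
    and prob: "\<And>i T. i \<in> I \<Longrightarrow> T \<subseteq> I - N i - {i} \<Longrightarrow>
      real (card (A i \<inter> avoiding \<Omega> A T)) \<le> p * real (card (avoiding \<Omega> A T))"
    and p: "p \<le> x * (1 - x) ^ d"
  shows "avoiding \<Omega> A I \<noteq> {}"
proof -
  have "(1 - x) ^ card I * real (card (avoiding \<Omega> A {})) \<le> real (card (avoiding \<Omega> A (I \<union> {})))"
  proof (rule card_avoiding_Un_ge)
    fix j W assume jW: "j \<in> I" "j \<notin> W" "W \<subseteq> I \<union> {}"
    show "real (card (A j \<inter> avoiding \<Omega> A W)) \<le> x * real (card (avoiding \<Omega> A W))"
      by (rule local_lemma_conditional_bound[OF assms(1,3,4) _ deg prob p]) (use jW \<open>x < 1\<close> in auto)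
  qed (use assms(1,3,5) in auto)
  moreover have "0 < (1 - x) ^ card I * real (card \<Omega>)"
    using assms by (simp add: card_gt_0_iff)
  ultimately have "0 < card (avoiding \<Omega> A I)" by simp
  then show ?thesis by auto
qed

text \<open>
  The optimal choice \<open>x = 1 / (d + 1)\<close> in the local lemma costs at most a factor \<open>e\<close>, since
  \<open>(1 + 1/d)\<^sup>d \<le> e\<close>.
\<close>

lemma inverse_exp_le_power:
  fixes d :: nat
  assumes "0 < d"
  shows "1 / exp 1 \<le> (1 - 1 / (real d + 1)) ^ d"
proof -
  have "(1 + 1 / real d) ^ d \<le> exp (1 / real d) ^ d"
    using exp_ge_add_one_self[of "1 / real d"] by (intro power_mono) auto
  also have "\<dots> = exp 1"
    using assms by (simp flip: exp_of_nat_mult)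
  finally have "1 / exp 1 \<le> 1 / (1 + 1 / real d) ^ d"
    using assms by (intro divide_left_mono) (auto intro!: mult_pos_pos zero_less_power add_pos_nonneg)
  also have "\<dots> = (1 / (1 + 1 / real d)) ^ d"
    by (simp add: power_one_over)
  also have "1 / (1 + 1 / real d) = 1 - 1 / (real d + 1)"
    using assms by (simp add: field_simps)
  finally show ?thesis .
qed

lemma lovasz_local_lemma_symmetric:
  fixes p :: real
  assumes "finite \<Omega>" "\<Omega> \<noteq> {}" "finite I" "0 \<le> p"
    and deg: "\<And>i. i \<in> I \<Longrightarrow> card (I \<inter> N i) \<le> d"
    and prob: "\<And>i T. i \<in> I \<Longrightarrow> T \<subseteq> I - N i - {i} \<Longrightarrow>
      real (card (A i \<inter> avoiding \<Omega> A T)) \<le> p * real (card (avoiding \<Omega> A T))"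
    and ep: "exp 1 * (real d + 1) * p \<le> 1"
  shows "avoiding \<Omega> A I \<noteq> {}"
proof (cases "d = 0")
  \<comment> \<open>Here \<open>1 / (d + 1)\<close> is not below \<open>1\<close>; the events are independent and \<open>x = p\<close> works.\<close>
  case True
  have "p \<le> 1 / exp 1" using ep True by (simp add: field_simps)
  also have "\<dots> < 1" by simp
  finally have "p < 1" .
  then show ?thesis
    using assms True by (intro lovasz_local_lemma[where x = p and p = p and d = d and N = N]) auto
next
  case False
  have "p \<le> 1 / (real d + 1) * (1 / exp 1)"
  proof -
    have pos: "0 < exp 1 * (real d + 1)" by (intro mult_pos_pos) auto
    have "p \<le> 1 / (exp 1 * (real d + 1))"
      unfolding pos_le_divide_eq[OF pos] using ep by (simp add: mult.commute)
    then show ?thesis by (simp add: mult.commute)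
  qed
  also have "\<dots> \<le> 1 / (real d + 1) * (1 - 1 / (real d + 1)) ^ d"
    using inverse_exp_le_power False by (intro mult_left_mono) auto
  finally show ?thesis
    using assms False
    by (intro lovasz_local_lemma[where x = "1 / (real d + 1)" and p = p and d = d and N = N]) auto
qed

section \<open>Two-colourings and families of blocks\<close>

text \<open>
  A two-colouring of \<open>X\<close> is represented by the subset of elements coloured \<open>1\<close>.  A condition on
  the colours inside \<open>V\<close> and one on the colours outside \<open>V\<close> are independent, because a subset
  \<open>w\<close> of \<open>X\<close> amounts to the pair of \<open>w \<inter> V\<close> and \<open>w - V\<close>.
\<close>

lemma card_Pow_product:
  assumes "V \<subseteq> X"
  shows "card {w \<in> Pow X. P (w \<inter> V) \<and> Q (w - V)}
    = card {a \<in> Pow V. P a} * card {b \<in> Pow (X - V). Q b}"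
proof -
  have "bij_betw (\<lambda>w. (w \<inter> V, w - V)) {w \<in> Pow X. P (w \<inter> V) \<and> Q (w - V)}
      ({a \<in> Pow V. P a} \<times> {b \<in> Pow (X - V). Q b})"
  proof (rule bij_betw_byWitness[where f' = "\<lambda>(a, b). a \<union> b"])
    show "(\<lambda>(a, b). a \<union> b) ` ({a \<in> Pow V. P a} \<times> {b \<in> Pow (X - V). Q b})
        \<subseteq> {w \<in> Pow X. P (w \<inter> V) \<and> Q (w - V)}"
    proof clarify
      fix a b assume ab: "a \<subseteq> V" "P a" "b \<subseteq> X - V" "Q b"
      then have "(a \<union> b) \<inter> V = a" "(a \<union> b) - V = b" by auto
      with ab assms show "a \<union> b \<in> Pow X \<and> P ((a \<union> b) \<inter> V) \<and> Q ((a \<union> b) - V)" by auto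
    qed
  qed auto
  then show ?thesis by (simp only: bij_betw_same_card card_cartesian_product)
qed

definition monochromatic :: "'a set set \<Rightarrow> 'a set \<Rightarrow> bool" where
  "monochromatic P w \<longleftrightarrow> (\<forall>c\<in>P. c \<subseteq> w \<or> c \<inter> w = {})"

lemma monochromatic_Int:
  assumes "\<Union>P \<subseteq> V"
  shows "monochromatic P (w \<inter> V) \<longleftrightarrow> monochromatic P w"
  using assms unfolding monochromatic_def by blast

lemma monochromatic_Diff:
  assumes "\<Union>P \<inter> V = {}"
  shows "monochromatic P (w - V) \<longleftrightarrow> monochromatic P w"
  using assms unfolding monochromatic_def by blast

text \<open>
  A colouring of \<open>\<Union>P\<close> that is constant on every block can be recovered from the set of blocks on
  which it is \<open>1\<close>.
\<close>

lemma card_monochromatic_le: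
  assumes "finite P"
  shows "card {w \<in> Pow (\<Union>P). monochromatic P w} \<le> 2 ^ card P"
proof -
  let ?M = "{w \<in> Pow (\<Union>P). monochromatic P w}"
  have "inj_on (\<lambda>w. {c \<in> P. c \<subseteq> w}) ?M"
  proof (rule inj_on_inverseI[where g = Union])
    fix w assume "w \<in> ?M"
    then have sub: "w \<subseteq> \<Union>P" and mono: "\<And>c. c \<in> P \<Longrightarrow> c \<subseteq> w \<or> c \<inter> w = {}"
      by (auto simp: monochromatic_def)
    show "\<Union>{c \<in> P. c \<subseteq> w} = w"
    proof
      show "w \<subseteq> \<Union>{c \<in> P. c \<subseteq> w}"
      proof
        fix v assume "v \<in> w"
        then obtain c where "c \<in> P" "v \<in> c" using sub by auto
        then show "v \<in> \<Union>{c \<in> P. c \<subseteq> w}" using mono[of c] \<open>v \<in> w\<close> by auto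
      qed
    qed auto
  qed
  then have "card ?M \<le> card (Pow P)"
    by (rule card_inj_on_le) (use assms in auto)
  then show ?thesis using assms by (simp add: card_Pow)
qed

text \<open>
  Counting each neighbour once for each vertex it shares with \<open>P\<close>; every vertex of \<open>P\<close> already
  spends one of its \<open>r\<close> incidences on \<open>P\<close> itself.
\<close>

lemma card_neighbours_le:
  assumes "finite F" "P \<in> F" "finite (\<Union>P)"
    and deg: "\<And>v. v \<in> \<Union>P \<Longrightarrow> card {Q \<in> F. v \<in> \<Union>Q} \<le> r"
  shows "card {Q \<in> F. Q \<noteq> P \<and> \<Union>Q \<inter> \<Union>P \<noteq> {}} \<le> card (\<Union>P) * (r - 1)"
proof -
  have "{Q \<in> F. Q \<noteq> P \<and> \<Union>Q \<inter> \<Union>P \<noteq> {}} = (\<Union>v\<in>\<Union>P. {Q \<in> F. v \<in> \<Union>Q} - {P})"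
    by blast
  also have "card \<dots> \<le> (\<Sum>v\<in>\<Union>P. card ({Q \<in> F. v \<in> \<Union>Q} - {P}))"
    using assms(3) by (rule card_UN_le)
  also have "\<dots> \<le> (\<Sum>v\<in>\<Union>P. r - 1)"
  proof (rule sum_mono)
    fix v assume v: "v \<in> \<Union>P"
    have "card ({Q \<in> F. v \<in> \<Union>Q} - {P}) = card {Q \<in> F. v \<in> \<Union>Q} - 1"
      using v assms(2) by (intro card_Diff_singleton) auto
    then show "card ({Q \<in> F. v \<in> \<Union>Q} - {P}) \<le> r - 1"
      using deg[OF v] by simp
  qed
  finally show ?thesis by simp
qed

text \<open>
  The local lemma for the events that all blocks of a member of the family are monochromatic.
  With one block in each member this is the classical sufficient condition for a uniform
  hypergraph to be two-colourable.
\<close>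

lemma exists_splitting_set:
  fixes F :: "'a set set set"
  assumes "finite X" "finite F"
    and sub: "\<And>P. P \<in> F \<Longrightarrow> \<Union>P \<subseteq> X"
    and size: "\<And>P. P \<in> F \<Longrightarrow> card (\<Union>P) = k"
    and blocks: "\<And>P. P \<in> F \<Longrightarrow> card P = l"
    and deg: "\<And>v. v \<in> X \<Longrightarrow> card {P \<in> F. v \<in> \<Union>P} \<le> r"
    and bound: "exp 1 * (real (k * (r - 1)) + 1) * (2 ^ l / 2 ^ k) \<le> (1 :: real)"
  shows "\<exists>w\<subseteq>X. \<forall>P\<in>F. \<not> monochromatic P w"
proof -
  let ?A = "\<lambda>P. {w \<in> Pow X. monochromatic P w}"
  let ?N = "\<lambda>P. {Q \<in> F. Q \<noteq> P \<and> \<Union>Q \<inter> \<Union>P \<noteq> {}}"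
  have "avoiding (Pow X) ?A F \<noteq> {}"
  proof (rule lovasz_local_lemma_symmetric[where N = ?N, OF _ _ _ _ _ _ bound])
    fix P assume P: "P \<in> F"
    have finV: "finite (\<Union>P)" using sub[OF P] \<open>finite X\<close> by (rule finite_subset)
    show "card (F \<inter> ?N P) \<le> k * (r - 1)"
    proof -
      have "card (?N P) \<le> card (\<Union>P) * (r - 1)"
        using P sub deg finV \<open>finite F\<close> by (intro card_neighbours_le) auto
      moreover have "F \<inter> ?N P = ?N P" by auto
      ultimately show ?thesis using size[OF P] by simp
    qed
    fix T assume T: "T \<subseteq> F - ?N P - {P}"
    let ?V = "\<Union>P"
    let ?Q = "\<lambda>b. \<forall>R\<in>T. \<not> monochromatic R b"
    let ?b = "card {b \<in> Pow (X - ?V). ?Q b}"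
    have disj: "\<Union>R \<inter> ?V = {}" if "R \<in> T" for R
      using T that by auto
    have Q: "?Q (w - ?V) = ?Q w" for w
      using monochromatic_Diff[OF disj] by auto
    have Pint: "monochromatic P (w \<inter> ?V) = monochromatic P w" for w
      by (rule monochromatic_Int) simp
    have "avoiding (Pow X) ?A T = {w \<in> Pow X. True \<and> ?Q (w - ?V)}"
      unfolding avoiding_def Q by auto
    also have "card \<dots> = card {a \<in> Pow ?V. True} * ?b"
      by (rule card_Pow_product[OF sub[OF P]])
    also have "card {a \<in> Pow ?V. True} = 2 ^ k"
      using finV size[OF P] by (simp add: card_Pow flip: Pow_def)
    finally have avoid: "card (avoiding (Pow X) ?A T) = 2 ^ k * ?b" .
    have "?A P \<inter> avoiding (Pow X) ?A T
        = {w \<in> Pow X. monochromatic P (w \<inter> ?V) \<and> ?Q (w - ?V)}"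
      unfolding avoiding_def Q Pint by auto
    also have "card \<dots> = card {a \<in> Pow ?V. monochromatic P a} * ?b"
      by (rule card_Pow_product[OF sub[OF P]])
    also have "\<dots> \<le> 2 ^ l * ?b"
      using card_monochromatic_le[OF finite_UnionD[OF finV]] blocks[OF P] by simp
    finally have "real (card (?A P \<inter> avoiding (Pow X) ?A T)) \<le> real (2 ^ l * ?b)"
      by (rule of_nat_mono)
    also have "\<dots> = 2 ^ l / 2 ^ k * real (card (avoiding (Pow X) ?A T))"
      unfolding avoid by simp
    finally show "real (card (?A P \<inter> avoiding (Pow X) ?A T))
        \<le> 2 ^ l / 2 ^ k * real (card (avoiding (Pow X) ?A T))" .
  qed (use assms in auto)
  then show ?thesis unfolding avoiding_def by auto
qed

section \<open>Clauses and their components\<close>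

lemma equiv_reachability: "equiv UNIV ((C \<union> C\<inverse>)\<^sup>*)"
  by (intro equivI refl_rtrancl sym_rtrancl trans_rtrancl) (auto simp: sym_def)

lemma reachable_in_Field:
  assumes "(i, j) \<in> (C \<union> C\<inverse>)\<^sup>*" "i \<in> Field C"
  shows "j \<in> Field C"
  using assms by (induction rule: rtrancl_induct) (auto simp: Field_def)

lemma Union_components: "\<Union>(components C) = Field C"
  unfolding components_def quotient_def using reachable_in_Field by fastforce

lemma disjoint_components: "pairwise disjnt (components C)"
proof (rule pairwiseI)
  fix c d assume "c \<in> components C" "d \<in> components C" "c \<noteq> d"
  then show "disjnt c d"
    using quotient_disj[OF equiv_reachability, of c C d]
    unfolding components_def quotient_def disjnt_def by blast
qed

lemma length_clause_partition: "length (clause_partition C) = card (components C)"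
  by (metis clause_partition_def length_rev mset_sorted_list_of_multiset size_image_mset
      size_mset size_mset_set)

lemma sum_list_clause_partition:
  assumes "finite (Field C)"
  shows "sum_list (clause_partition C) = card (Field C)"
proof -
  have "sum_list (clause_partition C) = (\<Sum>c\<in>components C. card c)"
    by (simp add: clause_partition_def sum_unfold_sum_mset flip: sum_mset_sum_list)
  also have "\<dots> = card (\<Union>(components C))"
  proof (rule card_Union_disjoint[symmetric, OF disjoint_components])
    fix c assume "c \<in> components C"
    then have "c \<subseteq> Field C" using Union_components by blast
    then show "finite c" using assms finite_subset by blast
  qed
  finally show ?thesis by (simp add: Union_components)
qed

text \<open>
  If no edge of the graph is bichromatic, then colours are constant along paths, hence on
  components.
\<close>

lemma satisfies_clause_if_not_monochromatic:
  assumes "\<not> monochromatic (components C) w"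
  shows "satisfies_clause (\<lambda>i. of_bool (i \<in> w)) C"
proof (rule ccontr)
  assume unsat: "\<not> satisfies_clause (\<lambda>i. of_bool (i \<in> w)) C"
  have edge: "i \<in> w \<longleftrightarrow> j \<in> w" if "(i, j) \<in> C \<union> C\<inverse>" for i j
    using unsat that by (fastforce simp: satisfies_clause_def)
  have path: "i \<in> w \<longleftrightarrow> j \<in> w" if "(i, j) \<in> (C \<union> C\<inverse>)\<^sup>*" for i j
    using that by (induction rule: rtrancl_induct) (simp_all add: edge)
  have "monochromatic (components C) w"
    unfolding monochromatic_def components_def quotient_def using path by blast
  with assms show False by blast
qed

section \<open>Property B\<close>

lemma property_B_if_local_lemma_bound:
  assumes part: "integer_partition k p" and len: "length p = l" and "0 < k"
    and sched: "scheduling_problem n S" and unif: "uniform p S" and reg: "regular n k S"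
    and bound: "exp 1 * (real k * (real k - 1) + 1) * 2 powr (- real k) < 2 powr (- real l)"
  shows "property_B n S"
proof -
  have field: "Field C \<subseteq> {1..n}" if "C \<in> S" for C
    using sched that unfolding scheduling_problem_def Field_def by fastforce
  have finfield: "finite (Field C)" if "C \<in> S" for C
    using field[OF that] finite_subset by blast
  have deg: "card {P \<in> components ` S. v \<in> \<Union>P} \<le> k" if "v \<in> {1..n}" for v
  proof -
    have "{P \<in> components ` S. v \<in> \<Union>P} = components ` {C \<in> S. v \<in> Field C}"
      using Union_components by blast
    then show ?thesis using reg that unfolding regular_def by simp
  qed
  have "exp 1 * (real k * (real k - 1) + 1) / 2 ^ k < 1 / 2 ^ l"
    using bound by (simp add: powr_minus powr_realpow divide_simps)
  then have bound': "exp 1 * (real (k * (k - 1)) + 1) * (2 ^ l / 2 ^ k) \<le> (1 :: real)"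
    using \<open>0 < k\<close> by (simp add: field_simps of_nat_diff)
  have "\<exists>w\<subseteq>{1..n}. \<forall>P\<in>components ` S. \<not> monochromatic P w"
  proof (rule exists_splitting_set[OF _ _ _ _ _ deg bound'])
    show "finite (components ` S)" using sched by (simp add: scheduling_problem_def)
    fix P assume "P \<in> components ` S"
    then obtain C where C: "C \<in> S" "P = components C" by auto
    show "\<Union>P \<subseteq> {1..n}" using C field by (simp add: Union_components)
    have "clause_partition C = p" using unif C by (simp add: uniform_def)
    then show "card (\<Union>P) = k" "card P = l"
      using sum_list_clause_partition[OF finfield[OF C(1)]] length_clause_partition[of C] part len C
      by (auto simp: integer_partition_def Union_components)
  qed auto
  then obtain w where "\<And>C. C \<in> S \<Longrightarrow> \<not> monochromatic (components C) w" by blast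
  then have "solution (\<lambda>i. of_bool (i \<in> w)) S"
    by (simp add: solution_def satisfies_clause_if_not_monochromatic)
  then show ?thesis unfolding property_B_def by (intro exI conjI) auto
qed

lemma eventually_local_lemma_bound:
  "\<forall>\<^sub>F k in sequentially.
    exp 1 * (real k * (real k - 1) + 1) * 2 powr (- real k) < 2 powr (- real l)"
proof -
  have "(\<lambda>k. exp 1 * (real k * (real k - 1) + 1) * 2 powr (- real k)) \<longlonglongrightarrow> 0"
    by real_asymp
  then show ?thesis by (rule order_tendstoD) simp
qed

theorem corollary3p2:
  "(\<forall>k l p n S.
      0 < k \<and> integer_partition k p \<and> length p = l \<and> 1 \<notin> set p \<and>
      scheduling_problem n S \<and> uniform p S \<and> regular n k S \<and>
      exp 1 * (real k * (real k - 1) + 1) * 2 powr (- real k) < 2 powr (- real l)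
      \<longrightarrow> property_B n S) \<and>
   (\<forall>l>0. \<exists>K>0. \<forall>k\<ge>K. \<forall>p n S.
      integer_partition k p \<and> length p = l \<and> 1 \<notin> set p \<and>
      scheduling_problem n S \<and> uniform p S \<and> regular n k S
      \<longrightarrow> property_B n S)"
proof (intro conjI allI impI)
  fix k l :: nat and p n S
  assume "0 < k \<and> integer_partition k p \<and> length p = l \<and> 1 \<notin> set p \<and>
      scheduling_problem n S \<and> uniform p S \<and> regular n k S \<and>
      exp 1 * (real k * (real k - 1) + 1) * 2 powr (- real k) < 2 powr (- real l)"
  then show "property_B n S" by (intro property_B_if_local_lemma_bound[of k p l n S]) auto
next
  fix l :: nat
  obtain K where K: "\<And>k. k \<ge> K \<Longrightarrow>
      exp 1 * (real k * (real k - 1) + 1) * 2 powr (- real k) < 2 powr (- real l)"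
    using eventually_local_lemma_bound[of l] unfolding eventually_sequentially by blast
  show "\<exists>K>0. \<forall>k\<ge>K. \<forall>p n S.
      integer_partition k p \<and> length p = l \<and> 1 \<notin> set p \<and>
      scheduling_problem n S \<and> uniform p S \<and> regular n k S
      \<longrightarrow> property_B n S"
  proof (intro exI[of _ "Suc K"] conjI allI impI)
    fix k p n S
    assume "Suc K \<le> k" and "integer_partition k p \<and> length p = l \<and> 1 \<notin> set p \<and>
      scheduling_problem n S \<and> uniform p S \<and> regular n k S"
    then show "property_B n S"
      using K[of k] by (intro property_B_if_local_lemma_bound[of k p l n S]) auto
  qed simp
qed

end
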